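(* Let $(\Omega_1,\mathscr{A}_1,\mu_1)$ and $(\Omega_2,\mathscr{A}_2,\mu_2)$ be two (potentially distinct) probability spaces. Let $(A_i)_{i\in\mathbb{N}}$ be a sequence of measurable sets in $\Omega_1$ and $(B_i)_{i\in\mathbb{N}}$ a sequence of measurable sets in $\Omega_2$. Suppose that for any $k\in\mathbb{N}$ and indices $i_1<i_2<\dots<i_k$ in $\mathbb{N}$, \[\mu_1(A_{i_1}\cap A_{i_2}\cap\dots\cap A_{i_k})\ge\mu_2(B_{i_1}\cap B_{i_2}\cap\dots\cap B_{i_k})\quad\text{if }k\text{ is odd, and}\] \[\mu_1(A_{i_1}\cap A_{i_2}\cap\dots\cap A_{i_k})\le\mu_2(B_{i_1}\cap B_{i_2}\cap\dots\cap B_{i_k})\quad\text{if }k\text{ is even.}\] Then $\mu_1(\limsup_{i\to\infty}A_i)\ge\mu_2(\limsup_{i\to\infty}B_i)$.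
   Context: $\mathbb{N}=\{1,2,3,\dots\}$. For a sequence of sets $(A_i)_{i\in\mathbb{N}}$, $\limsup_{i\to\infty}A_i=\bigcap_{n\ge1}\bigcup_{i\ge n}A_i$ is the set of points lying in $A_i$ for infinitely many $i$. *)

theory Defs
  imports "HOL-Probability.Probability"
begin

end

theory Submission
  imports Defs
begin

text \<open>
  By inclusion-exclusion, the measure of a finite union is the sum of the measures of the
  intersections of its nonempty subfamilies, with sign \<open>+\<close> for an odd and \<open>-\<close> for an even number of
  sets. The hypotheses compare these intersections in a direction that alternates in the same way,
  so every signed term for \<open>A\<close> is at least the corresponding term for \<open>B\<close>, and hence each finite
  union of the \<open>A i\<close> is at least as large in measure as the corresponding union of the \<open>B i\<close>
  (\<open>measure_UN_mono_alternating\<close>). This inequality survives two monotone limits: the finite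
  unions increase to the tails \<open>\<Union>i\<ge>n. A i\<close>, and the tails decrease to the limit superior.
\<close>

lemma (in finite_measure) measure_UN_inclusion_exclusion:
  assumes "finite I" and "\<And>i. i \<in> I \<Longrightarrow> A i \<in> sets M"
  shows "measure M (\<Union>i\<in>I. A i)
    = (\<Sum>J | J \<subseteq> I \<and> J \<noteq> {}. (-1) ^ (card J + 1) * measure M (\<Inter>j\<in>J. A j))"
proof -
  interpret Incl_Excl "\<lambda>S. S \<in> sets M" "measure M"
    by unfold_locales (auto simp: disjnt_def finite_measure_Union)
  show ?thesis
    using restricted_indexed[of I A] assms by simp
qed

text \<open>
  The sign \<open>(-1) ^ (card J + 1)\<close> turns both families of inequalities into the same direction, so
  the two inclusion-exclusion sums compare term by term.
\<close>

lemma measure_UN_mono_alternating: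
  fixes M1 :: "'a measure" and M2 :: "'b measure"
    and A :: "'i \<Rightarrow> 'a set" and B :: "'i \<Rightarrow> 'b set"
  assumes "finite_measure M1" and "finite_measure M2" and "finite I"
    and "\<And>i. i \<in> I \<Longrightarrow> A i \<in> sets M1" and "\<And>i. i \<in> I \<Longrightarrow> B i \<in> sets M2"
    and odd_ge: "\<And>J. J \<subseteq> I \<Longrightarrow> odd (card J) \<Longrightarrow>
      measure M2 (\<Inter>j\<in>J. B j) \<le> measure M1 (\<Inter>j\<in>J. A j)"
    and even_le: "\<And>J. J \<subseteq> I \<Longrightarrow> J \<noteq> {} \<Longrightarrow> even (card J) \<Longrightarrow>
      measure M1 (\<Inter>j\<in>J. A j) \<le> measure M2 (\<Inter>j\<in>J. B j)"
  shows "measure M2 (\<Union>i\<in>I. B i) \<le> measure M1 (\<Union>i\<in>I. A i)"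
proof -
  have "(-1) ^ (card J + 1) * measure M2 (\<Inter>j\<in>J. B j)
      \<le> (-1) ^ (card J + 1) * measure M1 (\<Inter>j\<in>J. A j)" if "J \<subseteq> I" "J \<noteq> {}" for J
    using odd_ge[of J] even_le[of J] that by (cases "even (card J)") auto
  then have "(\<Sum>J | J \<subseteq> I \<and> J \<noteq> {}. (-1) ^ (card J + 1) * measure M2 (\<Inter>j\<in>J. B j))
      \<le> (\<Sum>J | J \<subseteq> I \<and> J \<noteq> {}. (-1) ^ (card J + 1) * measure M1 (\<Inter>j\<in>J. A j))"
    by (intro sum_mono) blast
  then show ?thesis
    using finite_measure.measure_UN_inclusion_exclusion[OF assms(1), of I A]
      finite_measure.measure_UN_inclusion_exclusion[OF assms(2), of I B] assms(3-5)
    by presburger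
qed

lemma (in finite_measure) measure_UN_atLeastAtMost_tendsto:
  fixes A :: "nat \<Rightarrow> 'a set"
  assumes "\<And>i. n \<le> i \<Longrightarrow> A i \<in> sets M"
  shows "(\<lambda>N. measure M (\<Union>i\<in>{n..N}. A i)) \<longlonglongrightarrow> measure M (\<Union>i\<in>{n..}. A i)"
proof -
  have "(\<lambda>N. measure M (\<Union>i\<in>{n..N}. A i)) \<longlonglongrightarrow> measure M (\<Union>N. \<Union>i\<in>{n..N}. A i)"
    using assms by (intro finite_Lim_measure_incseq) (fastforce simp: incseq_def)+
  moreover have "(\<Union>N. \<Union>i\<in>{n..N}. A i) = (\<Union>i\<in>{n..}. A i)"
    by fastforce
  ultimately show ?thesis
    by simp
qed

text \<open>
  The tails start at \<open>Suc n\<close> because measurability is assumed from index 1 on; discarding the set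
  at index 0 leaves the limit superior unchanged.
\<close>

lemma (in finite_measure) measure_tail_tendsto_limsup:
  fixes A :: "nat \<Rightarrow> 'a set"
  assumes "\<And>i. 1 \<le> i \<Longrightarrow> A i \<in> sets M"
  shows "(\<lambda>n. measure M (\<Union>i\<in>{Suc n..}. A i)) \<longlonglongrightarrow> measure M (limsup A)"
proof -
  have "(\<lambda>n. measure M (\<Union>i\<in>{Suc n..}. A i)) \<longlonglongrightarrow> measure M (\<Inter>n. \<Union>i\<in>{Suc n..}. A i)"
    using assms by (intro finite_Lim_measure_decseq) (fastforce simp: decseq_def)+
  moreover have "(\<Inter>n. \<Union>i\<in>{Suc n..}. A i) = limsup A"
    unfolding limsup_INF_SUP by (auto simp: Bex_def) (meson Suc_leD)
  ultimately show ?thesis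
    by simp
qed

text \<open>
  Inclusion-exclusion sums over index sets, whereas the alternating hypotheses are about increasing
  index tuples \<open>i 1 < \<dots> < i k\<close>; this enumeration translates between the two.
\<close>

lemma obtain_strict_mono_enumeration_from_1:
  fixes J :: "nat set"
  assumes "finite J"
  obtains i where "strict_mono_on {1..card J} i" and "J = i ` {1..card J}"
proof -
  obtain h where h: "bij_betw h {..<card J} J" "strict_mono_on {..<card J} h"
    using ex_bij_betw_strict_mono_card[OF assms] .
  have pred: "bij_betw (\<lambda>j. j - 1) {1..card J} {..<card J}"
    by (rule bij_betw_byWitness[where f' = Suc]) auto
  have "strict_mono_on {1..card J} (\<lambda>j. h (j - 1))"
    by (rule strict_mono_onI, rule strict_mono_onD[OF h(2)]) auto
  moreover have "J = (\<lambda>j. h (j - 1)) ` {1..card J}"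
    using bij_betw_imp_surj_on[OF bij_betw_trans[OF pred h(1)]] by (simp add: o_def)
  ultimately show thesis
    using that by blast
qed

theorem theorem1p4:
  fixes M1 :: "'a measure" and M2 :: "'b measure"
    and A :: "nat \<Rightarrow> 'a set" and B :: "nat \<Rightarrow> 'b set"
  assumes "prob_space M1" and "prob_space M2"
    and "\<And>i. 1 \<le> i \<Longrightarrow> A i \<in> sets M1"
    and "\<And>i. 1 \<le> i \<Longrightarrow> B i \<in> sets M2"
    and "\<And>(k::nat) (i::nat \<Rightarrow> nat). 1 \<le> k \<Longrightarrow> odd k \<Longrightarrow>
           strict_mono_on {1..k} i \<Longrightarrow> (\<forall>j\<in>{1..k}. 1 \<le> i j) \<Longrightarrow>
           measure M1 (\<Inter>j\<in>{1..k}. A (i j)) \<ge> measure M2 (\<Inter>j\<in>{1..k}. B (i j))"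
    and "\<And>(k::nat) (i::nat \<Rightarrow> nat). 1 \<le> k \<Longrightarrow> even k \<Longrightarrow>
           strict_mono_on {1..k} i \<Longrightarrow> (\<forall>j\<in>{1..k}. 1 \<le> i j) \<Longrightarrow>
           measure M1 (\<Inter>j\<in>{1..k}. A (i j)) \<le> measure M2 (\<Inter>j\<in>{1..k}. B (i j))"
  shows "measure M1 (limsup A) \<ge> measure M2 (limsup B)"
proof -
  interpret M1: prob_space M1 by fact
  interpret M2: prob_space M2 by fact
  have finite_unions: "measure M2 (\<Union>i\<in>{Suc n..N}. B i) \<le> measure M1 (\<Union>i\<in>{Suc n..N}. A i)" for n N
  proof (rule measure_UN_mono_alternating)
    fix J assume J: "J \<subseteq> {Suc n..N}"
    then have "finite J"
      using finite_subset by auto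
    then obtain i where mono: "strict_mono_on {1..card J} i" and J_eq: "J = i ` {1..card J}"
      using obtain_strict_mono_enumeration_from_1 by blast
    have pos: "\<forall>j\<in>{1..card J}. 1 \<le> i j"
    proof
      fix j assume "j \<in> {1..card J}"
      then have "i j \<in> J"
        using J_eq by blast
      with J show "1 \<le> i j"
        by auto
    qed
    have Inter_eq: "(\<Inter>j\<in>J. C j) = (\<Inter>j\<in>{1..card J}. C (i j))" for C :: "nat \<Rightarrow> 'c set"
      by (subst J_eq) simp
    show "measure M2 (\<Inter>j\<in>J. B j) \<le> measure M1 (\<Inter>j\<in>J. A j)" if "odd (card J)"
      using assms(5)[OF _ that mono pos] odd_pos[OF that] by (simp add: Inter_eq)
    show "measure M1 (\<Inter>j\<in>J. A j) \<le> measure M2 (\<Inter>j\<in>J. B j)" if "J \<noteq> {}" "even (card J)"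
      using assms(6)[OF _ that(2) mono pos] \<open>finite J\<close> that(1)
      by (simp add: Inter_eq card_gt_0_iff Suc_le_eq)
  qed (use assms in \<open>auto intro: M1.finite_measure_axioms M2.finite_measure_axioms\<close>)
  have "measure M2 (\<Union>i\<in>{Suc n..}. B i) \<le> measure M1 (\<Union>i\<in>{Suc n..}. A i)" for n
    by (rule LIMSEQ_le[OF M2.measure_UN_atLeastAtMost_tendsto M1.measure_UN_atLeastAtMost_tendsto])
      (use assms finite_unions in auto)
  then show ?thesis
    by (intro LIMSEQ_le[OF M2.measure_tail_tendsto_limsup M1.measure_tail_tendsto_limsup])
      (use assms in auto)
qed

end
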